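(* Let $G$ be a finite, simple, connected graph and let $D\subseteq V(G)$ be a connected two-way two-step dominating set of $G$. Then $$pc(G)\leq pc(G[D])+2.$$
   Context: For an edge-colored graph, a path is a proper path if no two adjacent (consecutive) edges of the path receive the same color. An edge-coloring of a connected graph $G$ is a proper-path coloring if every pair of distinct vertices $u,v$ is joined by a proper $u$-$v$ path. The proper connection number $pc(G)$ is the minimum number of colors in a proper-path coloring of $G$. $G[D]$ denotes the subgraph induced by $D$. For $S\subseteq V(G)$, $d(v,S)=\min_{x\in S} d(v,x)$ and $N^k(S)=\{x\in V(G): d(x,S)=k\}$. A pendant vertex is a vertex of degree 1. A set $D$ is a two-step dominating set if every vertex of $G$ is at distance at most 2 from $D$. A two-step dominating set $D$ is a two-way two-step dominating set if (i) every pendant vertex of $G$ lies in $D$, and (ii) every vertex in $N^2(D)$ has at least two neighbors in $N^1(D)$. It is connected if $G[D]$ is connected. *)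

theory Defs
  imports Main
begin

text \<open>A graph is a vertex set \<open>V\<close> together with a set \<open>E\<close> of two-element subsets of \<open>V\<close>.\<close>

definition fin_simple_graph :: "'a set \<Rightarrow> 'a set set \<Rightarrow> bool" where
  "fin_simple_graph V E \<longleftrightarrow> finite V \<and> (\<forall>e\<in>E. e \<subseteq> V \<and> card e = 2)"

definition induced_edges :: "'a set set \<Rightarrow> 'a set \<Rightarrow> 'a set set" where
  "induced_edges E D = {e \<in> E. e \<subseteq> D}"

definition neighbors :: "'a set \<Rightarrow> 'a set set \<Rightarrow> 'a \<Rightarrow> 'a set" where
  "neighbors V E v = {w \<in> V. {v, w} \<in> E}"

definition pendant :: "'a set \<Rightarrow> 'a set set \<Rightarrow> 'a \<Rightarrow> bool" where
  "pendant V E v \<longleftrightarrow> v \<in> V \<and> card (neighbors V E v) = 1"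

definition is_path :: "'a set \<Rightarrow> 'a set set \<Rightarrow> 'a \<Rightarrow> 'a list \<Rightarrow> 'a \<Rightarrow> bool" where
  "is_path V E u p v \<longleftrightarrow>
     p \<noteq> [] \<and> hd p = u \<and> last p = v \<and> distinct p \<and> set p \<subseteq> V \<and>
     successively (\<lambda>x y. {x, y} \<in> E) p"

definition connected_graph :: "'a set \<Rightarrow> 'a set set \<Rightarrow> bool" where
  "connected_graph V E \<longleftrightarrow> V \<noteq> {} \<and> (\<forall>u\<in>V. \<forall>v\<in>V. \<exists>p. is_path V E u p v)"

fun path_edges :: "'a list \<Rightarrow> 'a set list" where
  "path_edges (x # y # zs) = {x, y} # path_edges (y # zs)"
| "path_edges _ = []"

definition proper_path ::
  "'a set \<Rightarrow> 'a set set \<Rightarrow> ('a set \<Rightarrow> nat) \<Rightarrow> 'a \<Rightarrow> 'a list \<Rightarrow> 'a \<Rightarrow> bool" where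
  "proper_path V E c u p v \<longleftrightarrow>
     is_path V E u p v \<and> successively (\<lambda>e f. c e \<noteq> c f) (path_edges p)"

definition proper_path_coloring :: "'a set \<Rightarrow> 'a set set \<Rightarrow> ('a set \<Rightarrow> nat) \<Rightarrow> bool" where
  "proper_path_coloring V E c \<longleftrightarrow>
     (\<forall>u\<in>V. \<forall>v\<in>V. u \<noteq> v \<longrightarrow> (\<exists>p. proper_path V E c u p v))"

text \<open>
  The proper connection number: the least \<open>k\<close> for which some \<open>c : E \<rightarrow> {1, \<dots>, k}\<close> is a
  proper-path coloring. The color set is nonempty, so \<open>pc(K\<^sub>1) = 1\<close>, in accordance with the
  usual fact that \<open>pc(G) = 1\<close> holds exactly for complete \<open>G\<close>.  Only meaningful for
  connected graphs.
\<close>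

definition pc :: "'a set \<Rightarrow> 'a set set \<Rightarrow> nat" where
  "pc V E = (LEAST k. 1 \<le> k \<and> (\<exists>c. c ` E \<subseteq> {1..k} \<and> proper_path_coloring V E c))"

text \<open>The following distances are only meaningful in connected graphs, and \<open>set_dist\<close>
  only for finite nonempty \<open>S\<close>.\<close>

definition graph_dist :: "'a set \<Rightarrow> 'a set set \<Rightarrow> 'a \<Rightarrow> 'a \<Rightarrow> nat" where
  "graph_dist V E u v = (LEAST n. \<exists>p. is_path V E u p v \<and> length (path_edges p) = n)"

definition set_dist :: "'a set \<Rightarrow> 'a set set \<Rightarrow> 'a \<Rightarrow> 'a set \<Rightarrow> nat" where
  "set_dist V E v S = Min (graph_dist V E v ` S)"

definition nbhd_at :: "'a set \<Rightarrow> 'a set set \<Rightarrow> nat \<Rightarrow> 'a set \<Rightarrow> 'a set" where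
  "nbhd_at V E k S = {x \<in> V. set_dist V E x S = k}"

definition two_step_dominating :: "'a set \<Rightarrow> 'a set set \<Rightarrow> 'a set \<Rightarrow> bool" where
  "two_step_dominating V E D \<longleftrightarrow>
     D \<subseteq> V \<and> D \<noteq> {} \<and> (\<forall>v\<in>V. set_dist V E v D \<le> 2)"

definition two_way_two_step_dominating :: "'a set \<Rightarrow> 'a set set \<Rightarrow> 'a set \<Rightarrow> bool" where
  "two_way_two_step_dominating V E D \<longleftrightarrow>
     two_step_dominating V E D \<and>
     (\<forall>v. pendant V E v \<longrightarrow> v \<in> D) \<and>
     (\<forall>v \<in> nbhd_at V E 2 D. 2 \<le> card (neighbors V E v \<inter> nbhd_at V E 1 D))"

definition connected_two_way_two_step_dominating ::
  "'a set \<Rightarrow> 'a set set \<Rightarrow> 'a set \<Rightarrow> bool" where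
  "connected_two_way_two_step_dominating V E D \<longleftrightarrow>
     two_way_two_step_dominating V E D \<and> connected_graph D (induced_edges E D)"

end

theory Submission
  imports Defs
begin

text \<open>
  Color \<open>G[D]\<close> optimally with \<open>k\<close> colors and let \<open>a\<close>, \<open>b\<close> be two new ones.  Link two vertices of
  \<open>N\<^sup>1(D)\<close> if they are adjacent or have a common neighbor in \<open>N\<^sup>2(D)\<close>, and label \<open>N\<^sup>1(D)\<close> with
  \<open>a\<close> and \<open>b\<close> so that every vertex with a link has a link to the opposite label.  An unlinked
  vertex has two neighbors in \<open>D\<close>, since it is not pendant; its edges to \<open>D\<close> receive both new
  colors.  All edges from a linked vertex to \<open>D\<close> receive its label, edges within \<open>N\<^sup>1(D)\<close> receive
  color 1, and an edge from \<open>p \<in> N\<^sup>1(D)\<close> to \<open>w \<in> N\<^sup>2(D)\<close> receives the label opposite to that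
  of \<open>p\<close>, except that a \<open>w\<close> whose neighbors in \<open>N\<^sup>1(D)\<close> all have the same label has one marked
  neighbor, whose edge to \<open>w\<close> receives that label.  Then from every vertex outside \<open>D\<close> there are
  proper paths entering \<open>D\<close> by an edge of color \<open>a\<close> and by one of color \<open>b\<close>.  Disjoint paths
  entering with different new colors are joined by a proper path within \<open>D\<close>.  Where disjointness
  fails, one of the paths ends, before entering \<open>D\<close>, at the other endpoint or at its marked
  neighbor; in the latter case the marked edge has the color of the edge into \<open>D\<close> and replaces it.
\<close>

section \<open>Proper walks\<close>

definition proper_walk :: "'a set set \<Rightarrow> ('a set \<Rightarrow> nat) \<Rightarrow> 'a list \<Rightarrow> bool" where
  "proper_walk E c p \<longleftrightarrow>
     successively (\<lambda>x y. {x, y} \<in> E) p \<and> successively (\<lambda>e f. c e \<noteq> c f) (path_edges p)"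

lemma proper_path_iff_proper_walk:
  "proper_path V E c u p v \<longleftrightarrow>
     p \<noteq> [] \<and> hd p = u \<and> last p = v \<and> distinct p \<and> set p \<subseteq> V \<and> proper_walk E c p"
  by (auto simp: proper_path_def is_path_def proper_walk_def)

lemma proper_walk_simps [simp]:
  "proper_walk E c []"
  "proper_walk E c [x]"
  "proper_walk E c (x # y # zs) \<longleftrightarrow>
     {x, y} \<in> E \<and> (zs \<noteq> [] \<longrightarrow> c {x, y} \<noteq> c {y, hd zs}) \<and> proper_walk E c (y # zs)"
  by (cases zs; auto simp: proper_walk_def)+

lemma proper_walk_append_Cons:
  "proper_walk E c (xs @ x # ys) \<longleftrightarrow>
     proper_walk E c (xs @ [x]) \<and> proper_walk E c (x # ys) \<and>
     (xs \<noteq> [] \<longrightarrow> ys \<noteq> [] \<longrightarrow> c {last xs, x} \<noteq> c {x, hd ys})"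
proof (induction xs rule: path_edges.induct)
  case (1 y z zs)
  then show ?case by (cases zs) auto
next
  case ("2_2" y)
  then show ?case by (cases ys) auto
qed simp

lemma proper_walk_snoc:
  assumes "xs \<noteq> []"
  shows "proper_walk E c (xs @ [x]) \<longleftrightarrow>
    proper_walk E c xs \<and> {last xs, x} \<in> E \<and>
    (butlast xs \<noteq> [] \<longrightarrow> c {last (butlast xs), last xs} \<noteq> c {last xs, x})"
  using assms proper_walk_append_Cons[of E c "butlast xs" "last xs" "[x]"]
  by (cases xs rule: rev_cases) auto

lemma proper_walk_rev [simp]: "proper_walk E c (rev p) \<longleftrightarrow> proper_walk E c p"
proof (induction p rule: path_edges.induct)
  case (1 x y zs)
  then show ?case
    using proper_walk_append_Cons[of E c "rev zs" y "[x]"]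
    by (auto simp: insert_commute last_rev)
qed auto

lemma proper_walk_mono: "proper_walk E c p \<Longrightarrow> E \<subseteq> F \<Longrightarrow> proper_walk F c p"
  by (induction p rule: path_edges.induct) auto

lemma proper_walk_cong:
  assumes "\<And>e. e \<in> E \<Longrightarrow> c e = c' e"
  shows "proper_walk E c p \<longleftrightarrow> proper_walk E c' p"
proof (induction p rule: path_edges.induct)
  case (1 x y zs)
  then show ?case using assms by (cases zs) auto
qed auto

lemma proper_path_coloring_cong:
  assumes "\<And>e. e \<in> E \<Longrightarrow> c e = c' e"
  shows "proper_path_coloring V E c \<longleftrightarrow> proper_path_coloring V E c'"
  unfolding proper_path_coloring_def proper_path_iff_proper_walk
  using proper_walk_cong[of E c c', OF assms] by simp

lemma proper_path_sym:
  assumes "\<exists>p. proper_path V E c u p v"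
  shows "\<exists>p. proper_path V E c v p u"
proof -
  obtain p where "proper_path V E c u p v" using assms ..
  then have "proper_path V E c v (rev p) u"
    by (simp add: proper_path_iff_proper_walk hd_rev last_rev)
  then show ?thesis ..
qed

lemma inj_on_imp_proper_walk:
  "\<lbrakk>inj_on c E; distinct p; successively (\<lambda>x y. {x, y} \<in> E) p\<rbrakk> \<Longrightarrow> proper_walk E c p"
proof (induction p rule: path_edges.induct)
  case (1 x y zs)
  then show ?case by (cases zs) (auto simp: inj_on_eq_iff doubleton_eq_iff)
qed auto

section \<open>The proper connection number\<close>

lemma inj_on_imp_proper_path_coloring:
  assumes "connected_graph V E" "inj_on c E"
  shows "proper_path_coloring V E c"
  using assms inj_on_imp_proper_walk
  unfolding connected_graph_def proper_path_coloring_def proper_path_iff_proper_walk is_path_def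
  by metis

lemma pc_attained:
  assumes "finite E" "connected_graph V E"
  obtains c where "1 \<le> pc V E" "c ` E \<subseteq> {1..pc V E}" "proper_path_coloring V E c"
proof -
  obtain h where h: "bij_betw h E {1..card E}"
    using finite_same_card_bij[OF assms(1), of "{1..card E}"] by auto
  have "h ` E \<subseteq> {1..Suc (card E)}" using bij_betw_imp_surj_on[OF h] by auto
  moreover have "proper_path_coloring V E h"
    using inj_on_imp_proper_path_coloring[OF assms(2)] bij_betw_imp_inj_on[OF h] .
  ultimately have "\<exists>k. 1 \<le> k \<and> (\<exists>c. c ` E \<subseteq> {1..k} \<and> proper_path_coloring V E c)"
    by (intro exI[of _ "Suc (card E)"]) auto
  from LeastI_ex[OF this] show ?thesis using that unfolding pc_def by blast
qed

lemma pc_le: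
  assumes "1 \<le> k" "c ` E \<subseteq> {1..k}" "proper_path_coloring V E c"
  shows "pc V E \<le> k"
  unfolding pc_def by (rule Least_le) (use assms in blast)

section \<open>Distance layers\<close>

lemma length_path_edges: "length (path_edges p) = length p - 1"
  by (induction p rule: path_edges.induct) auto

lemma graph_dist_attained:
  assumes "connected_graph V E" "u \<in> V" "v \<in> V"
  obtains p where "is_path V E u p v" "length (path_edges p) = graph_dist V E u v"
proof -
  have "\<exists>n p. is_path V E u p v \<and> length (path_edges p) = n"
    using assms unfolding connected_graph_def by blast
  from LeastI_ex[OF this] show ?thesis using that unfolding graph_dist_def by blast
qed

lemma graph_dist_self:
  assumes "u \<in> V"
  shows "graph_dist V E u u = 0"
proof -
  have "is_path V E u [u] u \<and> length (path_edges [u]) = 0" using assms by (simp add: is_path_def)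
  then show ?thesis unfolding graph_dist_def by (intro Least_eq_0) blast
qed

lemma graph_dist_eq_0_imp_eq:
  assumes "connected_graph V E" "u \<in> V" "v \<in> V" "graph_dist V E u v = 0"
  shows "u = v"
proof -
  obtain p where "is_path V E u p v" "length (path_edges p) = 0"
    using graph_dist_attained[OF assms(1-3)] assms(4) by metis
  then show ?thesis by (cases p) (auto simp: is_path_def length_path_edges)
qed

lemma graph_dist_eq_1_imp_edge:
  assumes "connected_graph V E" "u \<in> V" "v \<in> V" "graph_dist V E u v = 1"
  shows "{u, v} \<in> E"
proof -
  obtain p where "is_path V E u p v" "length (path_edges p) = 1"
    using graph_dist_attained[OF assms(1-3)] assms(4) by metis
  then show ?thesis
    by (cases p rule: path_edges.cases) (auto simp: is_path_def length_path_edges split: if_splits)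
qed

lemma set_dist_attained:
  assumes "finite S" "S \<noteq> {}"
  obtains x where "x \<in> S" "set_dist V E v S = graph_dist V E v x"
proof -
  have "set_dist V E v S \<in> graph_dist V E v ` S"
    unfolding set_dist_def using assms by (intro Min_in) auto
  then show ?thesis using that by blast
qed

lemma nbhd_at_0:
  assumes "connected_graph V E" "finite S" "S \<noteq> {}" "S \<subseteq> V"
  shows "nbhd_at V E 0 S = S"
proof
  show "nbhd_at V E 0 S \<subseteq> S"
  proof
    fix v assume "v \<in> nbhd_at V E 0 S"
    then have v: "v \<in> V" "set_dist V E v S = 0" by (auto simp: nbhd_at_def)
    obtain x where "x \<in> S" "graph_dist V E v x = 0"
      using set_dist_attained[OF assms(2,3)] v(2) by metis
    then show "v \<in> S" using graph_dist_eq_0_imp_eq[OF assms(1) v(1)] assms(4) by blast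
  qed
  show "S \<subseteq> nbhd_at V E 0 S"
  proof
    fix v assume v: "v \<in> S"
    then have "set_dist V E v S \<le> graph_dist V E v v"
      unfolding set_dist_def using assms(2) by auto
    then show "v \<in> nbhd_at V E 0 S"
      using v assms(4) by (auto simp: nbhd_at_def graph_dist_self)
  qed
qed

lemma nbhd_at_1_imp_edge:
  assumes "connected_graph V E" "finite S" "S \<noteq> {}" "S \<subseteq> V" "v \<in> nbhd_at V E 1 S"
  shows "\<exists>x\<in>S. {v, x} \<in> E"
proof -
  have v: "v \<in> V" "set_dist V E v S = 1" using assms(5) by (auto simp: nbhd_at_def)
  obtain x where "x \<in> S" "graph_dist V E v x = 1"
    using set_dist_attained[OF assms(2,3)] v(2) by metis
  then show ?thesis using graph_dist_eq_1_imp_edge[OF assms(1) v(1)] assms(4) by blast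
qed

section \<open>Labellings with opposite neighbors\<close>

text \<open>One label class is a maximal independent set.\<close>

lemma opposite_neighbor_labelling:
  assumes "finite N" "symp R" "irreflp R"
  shows "\<exists>label :: 'a \<Rightarrow> bool. \<forall>p\<in>N. (\<exists>q\<in>N. R p q) \<longrightarrow> (\<exists>q\<in>N. R p q \<and> label q \<noteq> label p)"
proof -
  define \<I> where "\<I> = {I. I \<subseteq> N \<and> (\<forall>p\<in>I. \<forall>q\<in>I. \<not> R p q)}"
  have "finite \<I>" "{} \<in> \<I>" using assms(1) by (auto simp: \<I>_def)
  then obtain I where I: "I \<in> \<I>" and maximal: "\<And>J. J \<in> \<I> \<Longrightarrow> I \<subseteq> J \<Longrightarrow> I = J"
    using finite_has_maximal[of \<I>] by (metis empty_iff)
  have "\<exists>r\<in>N. R p r \<and> (r \<in> I) \<noteq> (p \<in> I)" if pq: "p \<in> N" "q \<in> N" "R p q" for p q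
  proof (cases "p \<in> I")
    case True
    then show ?thesis using pq I unfolding \<I>_def by blast
  next
    case False
    then have "insert p I \<notin> \<I>" using maximal[of "insert p I"] by blast
    then obtain r where "r \<in> I" "R p r"
      using I pq(1) sympD[OF assms(2)] irreflpD[OF assms(3)] unfolding \<I>_def by auto
    then show ?thesis using False I unfolding \<I>_def by blast
  qed
  then show ?thesis by (intro exI[of _ "\<lambda>p. p \<in> I"]) blast
qed

section \<open>Entering a properly path-colored subgraph\<close>

locale path_colored_core =
  fixes V :: "'a set" and E :: "'a set set" and D :: "'a set"
    and c :: "'a set \<Rightarrow> nat" and k :: nat
  assumes core_subset: "D \<subseteq> V"
    and core_coloring: "proper_path_coloring D (induced_edges E D) c"
    and core_color_le: "e \<in> induced_edges E D \<Longrightarrow> c e \<le> k"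
begin

text \<open>The list \<open>P\<close> omits the endpoint in \<open>D\<close>; \<open>f\<close> is the color of the first edge and \<open>i\<close> that of
  the edge into \<open>D\<close>.\<close>

inductive entry_path :: "'a \<Rightarrow> 'a list \<Rightarrow> nat \<Rightarrow> nat \<Rightarrow> bool" where
  entry_path_edge: "entry_path u [u] (c {u, x}) (c {u, x})"
    if "u \<in> V - D" "x \<in> D" "{u, x} \<in> E"
| entry_path_Cons: "entry_path u (u # P) (c {u, p}) i"
    if "entry_path p P f i" "u \<in> V - D" "u \<notin> set P" "{u, p} \<in> E" "c {u, p} \<noteq> f"

lemma entry_path_is_path:
  assumes "entry_path u P f i"
  shows "P \<noteq> []" "hd P = u" "distinct P" "set P \<subseteq> V - D"
  using assms by (induction rule: entry_path.induct) auto

lemma entry_path_proper_walk: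
  assumes "entry_path u P f i"
  obtains x where "x \<in> D" "proper_walk E c (P @ [x])" "c {last P, x} = i"
proof -
  have "\<exists>x\<in>D. proper_walk E c (P @ [x]) \<and> c {last P, x} = i \<and> c {u, hd (tl P @ [x])} = f"
    using assms
  proof (induction rule: entry_path.induct)
    case (entry_path_Cons p P f i u)
    obtain P' where "P = p # P'"
      using entry_path_is_path(1,2)[OF entry_path_Cons.hyps(1)] by (cases P) auto
    then show ?case using entry_path_Cons by auto
  qed auto
  then show ?thesis using that by blast
qed

lemma entry_path_imp_proper_path:
  assumes "entry_path u P f i"
  shows "proper_path V E c u P (last P)"
proof -
  note P = entry_path_is_path[OF assms]
  obtain x where "proper_walk E c (P @ [x])" using entry_path_proper_walk[OF assms] .
  then show ?thesis using P by (auto simp: proper_path_iff_proper_walk proper_walk_snoc)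
qed

lemma entry_path_redirect:
  assumes "entry_path u P f i" "v \<in> V - set P" "{last P, v} \<in> E" "c {last P, v} = i"
  shows "proper_path V E c u (P @ [v]) v"
proof -
  note P = entry_path_is_path[OF assms(1)]
  obtain x where "proper_walk E c (P @ [x])" "c {last P, x} = i"
    using entry_path_proper_walk[OF assms(1)] .
  then have "proper_walk E c (P @ [v])" using assms(3,4) P(1) by (simp add: proper_walk_snoc)
  then show ?thesis using P assms(2) by (auto simp: proper_path_iff_proper_walk)
qed

lemma proper_path_within_core:
  assumes "x \<in> D" "y \<in> D" "x \<noteq> y"
  obtains d where "proper_path D (induced_edges E D) c x (d @ [y]) y" "d \<noteq> []"
    "proper_walk E c (d @ [y])" "{last d, y} \<in> induced_edges E D"
proof -
  obtain p where p: "proper_path D (induced_edges E D) c x p y"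
    using core_coloring assms unfolding proper_path_coloring_def by blast
  then obtain d where d: "p = d @ [y]"
    unfolding proper_path_iff_proper_walk by (metis append_butlast_last_id)
  have "d \<noteq> []" using p assms(3) unfolding d proper_path_iff_proper_walk by auto
  moreover have "proper_walk (induced_edges E D) c (d @ [y])"
    using p unfolding d proper_path_iff_proper_walk by blast
  moreover from this have "proper_walk E c (d @ [y])"
    by (rule proper_walk_mono) (auto simp: induced_edges_def)
  ultimately show ?thesis using that p d by (simp add: proper_walk_snoc)
qed

lemma entry_path_extend:
  assumes "entry_path u P f i" "k < i" "y \<in> D"
  obtains R where "R \<noteq> []" "hd R = u" "distinct R" "set R \<subseteq> set P \<union> (D - {y})"
    "proper_walk E c (R @ [y])" "c {last R, y} \<le> k \<or> c {last R, y} = i"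
proof -
  note P = entry_path_is_path[OF assms(1)]
  obtain x where x: "x \<in> D" "proper_walk E c (P @ [x])" "c {last P, x} = i"
    using entry_path_proper_walk[OF assms(1)] .
  show ?thesis
  proof (cases "x = y")
    case True
    then show ?thesis using that[of P] P x by blast
  next
    case False
    obtain d where d: "proper_path D (induced_edges E D) c x (d @ [y]) y" "d \<noteq> []"
      "proper_walk E c (d @ [y])" "{last d, y} \<in> induced_edges E D"
      using proper_path_within_core[OF x(1) assms(3) False] .
    obtain d' where d': "d = x # d'"
      using d(1,2) by (cases d) (auto simp: proper_path_iff_proper_walk)
    have "{x, hd (d' @ [y])} \<in> induced_edges E D"
      using d(1) by (cases d') (auto simp: d' proper_path_iff_proper_walk)
    then have "c {last P, x} \<noteq> c {x, hd (d' @ [y])}"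
      using core_color_le x(3) assms(2) by (metis leD)
    then have "proper_walk E c ((P @ d) @ [y])"
      using x(2) d(3) proper_walk_append_Cons[of E c P x "d' @ [y]"] by (simp add: d')
    moreover have "c {last (P @ d), y} \<le> k" using d(2) core_color_le[OF d(4)] by simp
    moreover have "distinct (d @ [y])" "set d \<subseteq> D"
      using d(1) unfolding proper_path_iff_proper_walk by auto
    ultimately show ?thesis using that[of "P @ d"] P by auto
  qed
qed

lemma entry_path_to_core:
  assumes "entry_path u P f i" "k < i" "y \<in> D"
  shows "\<exists>p. proper_path V E c u p y"
proof -
  obtain R where "R \<noteq> []" "hd R = u" "distinct R" "set R \<subseteq> set P \<union> (D - {y})"
    "proper_walk E c (R @ [y])"
    using entry_path_extend[OF assms] .
  then have "proper_path V E c u (R @ [y]) y"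
    using entry_path_is_path(4)[OF assms(1)] core_subset assms(3)
    by (auto simp: proper_path_iff_proper_walk)
  then show ?thesis ..
qed

lemma entry_paths_join:
  assumes "entry_path u P f i" "entry_path v Q g j"
    and "k < i" "k < j" "i \<noteq> j" "set P \<inter> set Q = {}"
  shows "\<exists>p. proper_path V E c u p v"
proof -
  note P = entry_path_is_path[OF assms(1)] and Q = entry_path_is_path[OF assms(2)]
  obtain y where y: "y \<in> D" "proper_walk E c (Q @ [y])" "c {last Q, y} = j"
    using entry_path_proper_walk[OF assms(2)] .
  obtain R where R: "R \<noteq> []" "hd R = u" "distinct R" "set R \<subseteq> set P \<union> (D - {y})"
    "proper_walk E c (R @ [y])" "c {last R, y} \<le> k \<or> c {last R, y} = i"
    using entry_path_extend[OF assms(1,3) y(1)] .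
  have "proper_walk E c (y # rev Q)" using y(2) proper_walk_rev[of E c "Q @ [y]"] by simp
  moreover have "c {last R, y} \<noteq> c {y, hd (rev Q)}"
    using R(6) y(3) assms(4,5) Q(1) by (auto simp: hd_rev insert_commute)
  ultimately have "proper_walk E c (R @ y # rev Q)"
    using R(5) proper_walk_append_Cons[of E c R y "rev Q"] by blast
  moreover have "distinct (R @ y # rev Q)" using R(3,4) P(4) Q(3,4) y(1) assms(6) by auto
  ultimately have "proper_path V E c u (R @ y # rev Q) v"
    using R(1,2,4) P(4) Q(1,2,4) y(1) core_subset
    by (auto simp: proper_path_iff_proper_walk last_rev)
  then show ?thesis ..
qed

end

section \<open>Two-way two-step dominating sets\<close>

locale two_way_dominated =
  fixes V :: "'a set" and E :: "'a set set" and D :: "'a set"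
  assumes simple: "fin_simple_graph V E"
    and connected: "connected_graph V E"
    and dominating: "connected_two_way_two_step_dominating V E D"
begin

definition N1 :: "'a set" where
  "N1 = nbhd_at V E 1 D"

definition N2 :: "'a set" where
  "N2 = nbhd_at V E 2 D"

lemma finite_V: "finite V"
  using simple by (simp add: fin_simple_graph_def)

lemma finite_E: "finite E"
proof -
  have "E \<subseteq> Pow V" using simple by (auto simp: fin_simple_graph_def)
  then show ?thesis using finite_V by (meson finite_Pow_iff finite_subset)
qed

lemma edge_in_V: "{u, v} \<in> E \<Longrightarrow> u \<in> V \<and> v \<in> V"
  using simple unfolding fin_simple_graph_def by blast

lemma edge_neq: "{u, v} \<in> E \<Longrightarrow> u \<noteq> v"
  using simple unfolding fin_simple_graph_def by fastforce

lemma two_step_dominating: "two_step_dominating V E D"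
  using dominating
  by (simp add: connected_two_way_two_step_dominating_def two_way_two_step_dominating_def)

lemma D_subset: "D \<subseteq> V" and D_nonempty: "D \<noteq> {}"
  using two_step_dominating by (auto simp: two_step_dominating_def)

lemma finite_D: "finite D"
  using D_subset finite_V by (rule finite_subset)

lemma D_eq_nbhd_at_0: "D = nbhd_at V E 0 D"
  using nbhd_at_0[OF connected finite_D D_nonempty D_subset] ..

lemma layers_disjoint: "D \<inter> N1 = {}" "D \<inter> N2 = {}" "N1 \<inter> N2 = {}"
proof -
  have "set_dist V E v D = 0" if "v \<in> D" for v
    using that D_eq_nbhd_at_0 unfolding nbhd_at_def by blast
  then show "D \<inter> N1 = {}" "D \<inter> N2 = {}" "N1 \<inter> N2 = {}"
    by (auto simp: N1_def N2_def nbhd_at_def)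
qed

lemma V_eq_layers: "V = D \<union> N1 \<union> N2"
proof -
  have "set_dist V E v D = 0 \<or> set_dist V E v D = 1 \<or> set_dist V E v D = 2" if "v \<in> V" for v
    using two_step_dominating that unfolding two_step_dominating_def by fastforce
  then have "V = nbhd_at V E 0 D \<union> nbhd_at V E 1 D \<union> nbhd_at V E 2 D"
    by (auto simp: nbhd_at_def)
  then show ?thesis using D_eq_nbhd_at_0 by (simp add: N1_def N2_def)
qed

lemma N1_has_neighbor_in_D: "p \<in> N1 \<Longrightarrow> \<exists>x\<in>D. {p, x} \<in> E"
  using nbhd_at_1_imp_edge[OF connected finite_D D_nonempty D_subset] by (simp add: N1_def)

lemma N1_has_other_neighbor:
  assumes "p \<in> N1" "{p, x} \<in> E"
  obtains y where "y \<noteq> x" "{p, y} \<in> E"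
proof -
  have "p \<in> V" "p \<notin> D" using assms(1) V_eq_layers layers_disjoint by auto
  then have "card (neighbors V E p) \<noteq> 1"
    using dominating
    unfolding connected_two_way_two_step_dominating_def two_way_two_step_dominating_def pendant_def
    by blast
  then have "neighbors V E p \<noteq> {x}" by auto
  moreover have "x \<in> neighbors V E p" using assms(2) edge_in_V by (auto simp: neighbors_def)
  ultimately show ?thesis using that by (auto simp: neighbors_def)
qed

lemma N2_has_two_neighbors_in_N1:
  assumes "w \<in> N2"
  obtains p q where "p \<in> N1" "q \<in> N1" "p \<noteq> q" "{w, p} \<in> E" "{w, q} \<in> E"
proof -
  have "2 \<le> card (neighbors V E w \<inter> N1)"
    using dominating assms
    unfolding connected_two_way_two_step_dominating_def two_way_two_step_dominating_def
      N1_def N2_def by blast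
  then obtain T where "T \<subseteq> neighbors V E w \<inter> N1" "card T = 2"
    by (rule obtain_subset_with_card_n)
  then obtain p q where "{p, q} \<subseteq> neighbors V E w \<inter> N1" "p \<noteq> q" by (auto simp: card_2_iff)
  then show ?thesis using that by (auto simp: neighbors_def)
qed

definition linked :: "'a \<Rightarrow> 'a \<Rightarrow> bool" where
  "linked p q \<longleftrightarrow> p \<noteq> q \<and> ({p, q} \<in> E \<or> (\<exists>w\<in>N2. {w, p} \<in> E \<and> {w, q} \<in> E))"

definition isolated :: "'a \<Rightarrow> bool" where
  "isolated p \<longleftrightarrow> (\<forall>q\<in>N1. \<not> linked p q)"

definition foot :: "'a \<Rightarrow> 'a" where
  "foot p = (SOME x. x \<in> D \<and> {p, x} \<in> E)"

definition mark :: "'a \<Rightarrow> 'a" where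
  "mark w = (SOME p. p \<in> N1 \<and> {w, p} \<in> E)"

lemma symp_linked: "symp linked"
  by (rule sympI) (auto simp: linked_def insert_commute)

lemma irreflp_linked: "irreflp linked"
  by (rule irreflpI) (simp add: linked_def)

lemma foot: "p \<in> N1 \<Longrightarrow> foot p \<in> D \<and> {p, foot p} \<in> E"
  using someI_ex[of "\<lambda>x. x \<in> D \<and> {p, x} \<in> E"] N1_has_neighbor_in_D by (auto simp: foot_def)

lemma mark:
  assumes "w \<in> N2"
  shows "mark w \<in> N1" "{w, mark w} \<in> E"
proof -
  have "\<exists>p. p \<in> N1 \<and> {w, p} \<in> E"
    using N2_has_two_neighbors_in_N1[OF assms] by metis
  from someI_ex[OF this] show "mark w \<in> N1" "{w, mark w} \<in> E" by (simp_all add: mark_def)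
qed

lemma N2_has_unmarked_neighbor:
  assumes "w \<in> N2"
  obtains p where "p \<in> N1" "p \<noteq> mark w" "{w, p} \<in> E"
proof -
  obtain p q where "p \<in> N1" "q \<in> N1" "p \<noteq> q" "{w, p} \<in> E" "{w, q} \<in> E"
    using N2_has_two_neighbors_in_N1[OF assms] .
  then show ?thesis using that by metis
qed

lemma N2_neighbor_not_isolated:
  assumes "w \<in> N2" "p \<in> N1" "{w, p} \<in> E"
  shows "\<not> isolated p"
proof -
  obtain q where "q \<in> N1" "q \<noteq> p" "{w, q} \<in> E"
    using N2_has_two_neighbors_in_N1[OF assms(1)] by metis
  then have "linked p q" using assms unfolding linked_def by blast
  then show ?thesis using \<open>q \<in> N1\<close> unfolding isolated_def by blast
qed

lemma isolated_has_second_foot: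
  assumes "p \<in> N1" "isolated p"
  obtains x where "x \<in> D" "x \<noteq> foot p" "{p, x} \<in> E"
proof -
  obtain x where x: "x \<noteq> foot p" "{p, x} \<in> E"
    using N1_has_other_neighbor foot assms(1) by metis
  have "x \<notin> N1" using x assms(2) edge_neq by (auto simp: isolated_def linked_def)
  moreover have "x \<notin> N2"
    using N2_neighbor_not_isolated[of x p] x assms by (auto simp: insert_commute)
  ultimately have "x \<in> D" using edge_in_V[OF x(2)] V_eq_layers by blast
  then show ?thesis using that x by blast
qed

lemma ex_label_opposite_to_linked:
  "\<exists>label :: 'a \<Rightarrow> bool. \<forall>p\<in>N1. \<not> isolated p \<longrightarrow> (\<exists>q\<in>N1. linked p q \<and> label q \<noteq> label p)"
proof -
  have "finite N1" using finite_V by (simp add: N1_def nbhd_at_def)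
  then show ?thesis
    using opposite_neighbor_labelling[OF _ symp_linked irreflp_linked] by (simp add: isolated_def)
qed

lemma core_pc_attained:
  obtains cD where "1 \<le> pc D (induced_edges E D)"
    "cD ` induced_edges E D \<subseteq> {1..pc D (induced_edges E D)}"
    "proper_path_coloring D (induced_edges E D) cD"
proof -
  have "finite (induced_edges E D)" using finite_E by (simp add: induced_edges_def)
  moreover have "connected_graph D (induced_edges E D)"
    using dominating by (simp add: connected_two_way_two_step_dominating_def)
  ultimately show ?thesis using that by (rule pc_attained)
qed

end

section \<open>Extending the coloring by two colors\<close>

locale two_way_dominated_coloring = two_way_dominated +
  fixes label :: "'a \<Rightarrow> bool" and cD :: "'a set \<Rightarrow> nat" and k :: nat
  assumes label_opposite:
      "\<lbrakk>p \<in> N1; \<not> isolated p\<rbrakk> \<Longrightarrow> \<exists>q\<in>N1. linked p q \<and> label q \<noteq> label p"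
    and k_pos: "1 \<le> k"
    and cD_range: "cD ` induced_edges E D \<subseteq> {1..k}"
    and cD_coloring: "proper_path_coloring D (induced_edges E D) cD"
begin

definition mixed :: "'a \<Rightarrow> bool" where
  "mixed w \<longleftrightarrow> (\<exists>p\<in>N1. \<exists>q\<in>N1. {w, p} \<in> E \<and> {w, q} \<in> E \<and> label p \<noteq> label q)"

definition new_color :: "bool \<Rightarrow> nat" where
  "new_color b = k + 1 + of_bool b"

definition flipped :: "'a \<Rightarrow> 'a \<Rightarrow> bool" where
  "flipped p x \<longleftrightarrow> x \<in> D \<and> isolated p \<and> x \<noteq> foot p \<or> x \<in> N2 \<and> (mixed x \<or> p \<noteq> mark x)"

definition ext_color :: "'a set \<Rightarrow> nat" where
  "ext_color e = (if e \<subseteq> D then cD e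
     else if e \<inter> N1 \<noteq> {} \<and> e - N1 \<noteq> {} then
       (let p = the_elem (e \<inter> N1); x = the_elem (e - N1) in new_color (label p \<noteq> flipped p x))
     else 1)"

lemma new_color_eq_iff [simp]: "new_color a = new_color b \<longleftrightarrow> a = b"
  by (simp add: new_color_def)

lemma new_color_gt: "k < new_color b"
  by (simp add: new_color_def)

lemma ext_color_within_D: "e \<subseteq> D \<Longrightarrow> ext_color e = cD e"
  by (simp add: ext_color_def)

lemma ext_color_within_N1:
  assumes "p \<in> N1" "q \<in> N1"
  shows "ext_color {p, q} = 1"
proof -
  have "{p, q} - N1 = {}" "\<not> {p, q} \<subseteq> D" using assms layers_disjoint by auto
  then show ?thesis unfolding ext_color_def by presburger
qed

lemma ext_color_N1:
  assumes "p \<in> N1" "x \<notin> N1"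
  shows "ext_color {p, x} = new_color (label p \<noteq> flipped p x)"
    and "ext_color {x, p} = new_color (label p \<noteq> flipped p x)"
proof -
  have "{p, x} \<inter> N1 = {p}" "{p, x} - N1 = {x}" "\<not> {p, x} \<subseteq> D"
    using assms layers_disjoint by auto
  then show "ext_color {p, x} = new_color (label p \<noteq> flipped p x)"
    unfolding ext_color_def by (simp del: insert_subset)
  then show "ext_color {x, p} = new_color (label p \<noteq> flipped p x)" by (simp add: insert_commute)
qed

lemma ext_color_range: "ext_color ` E \<subseteq> {1..k + 2}"
proof -
  have "ext_color e \<in> {1..k + 2}" if "e \<in> E" for e
  proof (cases "e \<subseteq> D")
    case True
    then have "cD e \<in> {1..k}" using that cD_range by (auto simp: induced_edges_def)
    then show ?thesis using True by (simp add: ext_color_within_D)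
  next
    case False
    then show ?thesis by (auto simp: ext_color_def Let_def new_color_def)
  qed
  then show ?thesis by blast
qed

sublocale path_colored_core V E D ext_color k
proof
  have color_eq: "ext_color e = cD e" if "e \<in> induced_edges E D" for e
    using that by (simp add: ext_color_within_D induced_edges_def)
  show "D \<subseteq> V" by (rule D_subset)
  show "proper_path_coloring D (induced_edges E D) ext_color"
    using cD_coloring proper_path_coloring_cong[of "induced_edges E D" ext_color cD D, OF color_eq]
    by blast
  show "ext_color e \<le> k" if "e \<in> induced_edges E D" for e
    using color_eq[OF that] cD_range that by fastforce
qed

definition flexible :: "'a \<Rightarrow> bool" where
  "flexible u \<longleftrightarrow> u \<in> N1 \<and> isolated u \<or> u \<in> N2 \<and> mixed u"

definition anchor :: "'a \<Rightarrow> 'a" where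
  "anchor u = (if u \<in> N1 then u else mark u)"

abbreviation side :: "'a \<Rightarrow> bool" where
  "side u \<equiv> label (anchor u)"

definition rigid_class :: "bool \<Rightarrow> 'a set" where
  "rigid_class b = {u \<in> N1 \<union> N2. \<not> flexible u \<and> side u = b}"

lemma N1_rigid_class_iff: "p \<in> N1 \<Longrightarrow> p \<in> rigid_class b \<longleftrightarrow> \<not> isolated p \<and> label p = b"
  using layers_disjoint by (auto simp: rigid_class_def flexible_def anchor_def)

lemma N2_rigid_class_iff: "w \<in> N2 \<Longrightarrow> w \<in> rigid_class b \<longleftrightarrow> \<not> mixed w \<and> label (mark w) = b"
  using layers_disjoint by (auto simp: rigid_class_def flexible_def anchor_def)

lemma entry_path_from_N1:
  assumes "p \<in> N1" "isolated p \<or> label p = b"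
  shows "entry_path p [p] (new_color b) (new_color b)"
proof -
  obtain x where x: "x \<in> D" "{p, x} \<in> E" "(label p \<noteq> flipped p x) = b"
  proof (cases "label p = b")
    case True
    then show ?thesis
      using that[of "foot p"] foot[OF assms(1)] layers_disjoint by (auto simp: flipped_def)
  next
    case False
    then have "isolated p" using assms(2) by blast
    then obtain x where "x \<in> D" "x \<noteq> foot p" "{p, x} \<in> E"
      using isolated_has_second_foot[OF assms(1)] by blast
    then show ?thesis using that[of x] False \<open>isolated p\<close> by (auto simp: flipped_def)
  qed
  have "p \<in> V - D" "x \<notin> N1" using assms(1) x(1) V_eq_layers layers_disjoint by auto
  then show ?thesis using entry_path_edge[of p x] x ext_color_N1(1)[OF assms(1)] by simp
qed

lemma entry_path_from_N2:
  assumes "w \<in> N2" "p \<in> N1" "{w, p} \<in> E" "mixed w \<or> p \<noteq> mark w"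
  shows "entry_path w [w, p] (new_color (\<not> label p)) (new_color (label p))"
proof -
  have w: "w \<in> V - D" "w \<notin> N1" "w \<noteq> p" using assms(1,2) V_eq_layers layers_disjoint by auto
  have "ext_color {w, p} = new_color (\<not> label p)"
    using ext_color_N1(2)[OF assms(2) w(2)] assms(1,4) by (simp add: flipped_def)
  then show ?thesis
    using entry_path_Cons[OF entry_path_from_N1[OF assms(2)] w(1) _ assms(3)] w(3) by simp
qed

lemma ext_color_mark:
  assumes "w \<in> N2" "\<not> mixed w"
  shows "ext_color {w, mark w} = new_color (label (mark w))"
proof -
  have "w \<notin> N1" "w \<notin> D" using assms(1) layers_disjoint by auto
  then show ?thesis
    using ext_color_N1(2)[OF mark(1)[OF assms(1)]] assms(2) by (simp add: flipped_def)
qed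

lemma unmixed_neighbor_label:
  assumes "w \<in> N2" "\<not> mixed w" "p \<in> N1" "{w, p} \<in> E"
  shows "label p = label (mark w)"
  using assms mark[OF assms(1)] unfolding mixed_def by blast

lemma entry_path_own_side:
  assumes "u \<in> N1 \<union> N2" "flexible u \<or> side u = b"
  obtains P f where "entry_path u P f (new_color b)"
    "set P \<subseteq> {u} \<union> N1 \<inter> rigid_class b" "set P \<inter> N1 = {last P}"
proof (cases "u \<in> N1")
  case True
  then have "isolated u \<or> label u = b"
    using assms(2) layers_disjoint by (auto simp: flexible_def anchor_def)
  then show ?thesis using that[of "[u]"] entry_path_from_N1[OF True] True by auto
next
  case False
  then have u: "u \<in> N2" using assms(1) by blast
  obtain p where p: "p \<in> N1" "{u, p} \<in> E" "mixed u \<or> p \<noteq> mark u" "label p = b"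
  proof (cases "mixed u")
    case True
    then show ?thesis using that unfolding mixed_def by blast
  next
    case unmixed: False
    obtain p where "p \<in> N1" "p \<noteq> mark u" "{u, p} \<in> E"
      using N2_has_unmarked_neighbor[OF u] .
    moreover from this have "label p = b"
      using unmixed_neighbor_label[OF u unmixed] assms(2) unmixed False
      by (simp add: flexible_def anchor_def)
    ultimately show ?thesis using that by blast
  qed
  then have "p \<in> rigid_class b"
    using N2_neighbor_not_isolated[OF u] by (simp add: N1_rigid_class_iff)
  then show ?thesis
    using that[of "[u, p]"] entry_path_from_N2[OF u p(1-3)] p(1,4) False by auto
qed

text \<open>The first edge avoids the label of \<open>p\<close>, so that a marked edge can be put in front.\<close>

lemma entry_path_opposite_label:
  assumes "p \<in> N1" "\<not> isolated p"
  obtains P f where "entry_path p P f (new_color (\<not> label p))" "f \<noteq> new_color (label p)"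
    "set P \<inter> rigid_class (label p) \<subseteq> {p}"
proof -
  obtain q where q: "q \<in> N1" "linked p q" "label q = (\<not> label p)"
    using label_opposite[OF assms] by blast
  have q_opposite: "q \<notin> rigid_class (label p)" using q(1,3) by (simp add: N1_rigid_class_iff)
  have p: "p \<in> V - D" "p \<noteq> q" using assms(1) q(3) V_eq_layers layers_disjoint by auto
  show ?thesis
  proof (cases "{p, q} \<in> E")
    case True
    have "ext_color {p, q} \<noteq> new_color b" for b
      using ext_color_within_N1[OF assms(1) q(1)] k_pos new_color_gt[of b] by simp
    moreover from this have "entry_path p [p, q] (ext_color {p, q}) (new_color (\<not> label p))"
      using entry_path_Cons[OF entry_path_from_N1[OF q(1)] p(1) _ True] p(2) q(3) by simp
    ultimately show ?thesis using that[of "[p, q]"] q_opposite by auto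
  next
    case False
    then obtain w where w: "w \<in> N2" "{w, p} \<in> E" "{w, q} \<in> E"
      using q(2) unfolding linked_def by blast
    have mixed: "mixed w" using w q(1,3) assms(1) unfolding mixed_def by blast
    have "w \<notin> N1" "w \<noteq> p" using w(1) assms(1) layers_disjoint by auto
    have color: "ext_color {p, w} = new_color (\<not> label p)"
      using ext_color_N1(1)[OF assms(1) \<open>w \<notin> N1\<close>] w(1) mixed by (simp add: flipped_def)
    have "entry_path w [w, q] (new_color (label p)) (new_color (\<not> label p))"
      using entry_path_from_N2[OF w(1) q(1) w(3)] mixed q(3) by simp
    then have "entry_path p [p, w, q] (new_color (\<not> label p)) (new_color (\<not> label p))"
      using entry_path_Cons[of w "[w, q]" _ _ p] p w(2) \<open>w \<noteq> p\<close> color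
      by (simp add: insert_commute)
    moreover have "new_color (\<not> label p) \<noteq> new_color (label p)" by simp
    moreover have "set [p, w, q] \<inter> rigid_class (label p) \<subseteq> {p}"
      using w(1) mixed q_opposite by (auto simp: N2_rigid_class_iff)
    ultimately show ?thesis by (rule that)
  qed
qed

lemma entry_path_opposite_side:
  assumes "u \<in> N1 \<union> N2" "\<not> flexible u"
  obtains P f where "entry_path u P f (new_color (\<not> side u))"
    "set P \<inter> rigid_class (side u) \<subseteq> {u, anchor u}"
proof (cases "u \<in> N1")
  case True
  then have "\<not> isolated u" "anchor u = u" using assms(2) by (auto simp: flexible_def anchor_def)
  then show ?thesis using entry_path_opposite_label[OF True] that by auto
next
  case False
  then have u: "u \<in> N2" "\<not> mixed u" "u \<in> V - D" "anchor u = mark u"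
    using assms V_eq_layers layers_disjoint by (auto simp: flexible_def anchor_def)
  note marked = mark[OF u(1)]
  obtain P f where P: "entry_path (mark u) P f (new_color (\<not> label (mark u)))"
    "f \<noteq> new_color (label (mark u))" "set P \<inter> rigid_class (label (mark u)) \<subseteq> {mark u}"
    using entry_path_opposite_label[OF marked(1) N2_neighbor_not_isolated[OF u(1) marked]] .
  have "u \<in> rigid_class (label (mark u))" "u \<noteq> mark u"
    using u(1,2) marked(1) False by (auto simp: N2_rigid_class_iff)
  then have "u \<notin> set P" using P(3) by blast
  then have "entry_path u (u # P) (ext_color {u, mark u}) (new_color (\<not> label (mark u)))"
    using entry_path_Cons[OF P(1) u(3) _ marked(2)] P(2) ext_color_mark[OF u(1,2)] by simp
  then show ?thesis using that[of "u # P"] P(3) u(4) by auto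
qed

lemma proper_path_opposite_sides:
  assumes "u \<in> N1 \<union> N2" "v \<in> N1 \<union> N2" "u \<noteq> v"
    and "flexible u \<or> side u = b" "flexible v \<or> side v = (\<not> b)"
  shows "\<exists>p. proper_path V E ext_color u p v"
proof -
  obtain P f where P: "entry_path u P f (new_color b)" "set P \<subseteq> {u} \<union> N1 \<inter> rigid_class b"
    using entry_path_own_side[OF assms(1,4)] .
  obtain Q g where Q: "entry_path v Q g (new_color (\<not> b))"
    "set Q \<subseteq> {v} \<union> N1 \<inter> rigid_class (\<not> b)"
    using entry_path_own_side[OF assms(2,5)] .
  have "u \<notin> rigid_class (\<not> b)" "v \<notin> rigid_class b" "rigid_class b \<inter> rigid_class (\<not> b) = {}"
    using assms(4,5) by (auto simp: rigid_class_def)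
  then have "set P \<inter> set Q = {}" using P(2) Q(2) assms(3) by blast
  then show ?thesis using entry_paths_join[OF P(1) Q(1)] new_color_gt by simp
qed

lemma proper_path_same_side:
  assumes "u \<in> N1 \<union> N2" "v \<in> N1 \<union> N2" "u \<noteq> v" "\<not> flexible u" "\<not> flexible v"
    and "side u = side v"
  shows "\<exists>p. proper_path V E ext_color u p v"
proof -
  obtain P f where P: "entry_path u P f (new_color (side v))"
    "set P \<subseteq> {u} \<union> N1 \<inter> rigid_class (side v)" "set P \<inter> N1 = {last P}"
    using entry_path_own_side[OF assms(1), of "side v"] assms(6) by blast
  obtain Q g where Q: "entry_path v Q g (new_color (\<not> side v))"
    "set Q \<inter> rigid_class (side v) \<subseteq> {v, anchor v}"
    using entry_path_opposite_side[OF assms(2,5)] .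
  have "set P \<subseteq> rigid_class (side v)" using P(2) assms(1,4,6) by (auto simp: rigid_class_def)
  then have "set P \<inter> set Q \<subseteq> {v, anchor v}" using Q(2) by blast
  then consider (through_v) "v \<in> set P" | (through_anchor) "v \<notin> set P" "anchor v \<in> set P"
    | (disjoint) "set P \<inter> set Q = {}"
    by blast
  then show ?thesis
  proof cases
    case through_v
    then have "last P = v" using P(2,3) assms(3) by auto
    then show ?thesis using entry_path_imp_proper_path[OF P(1)] by blast
  next
    case through_anchor
    then have v: "v \<in> N2" "\<not> mixed v" "v \<in> V" "anchor v = mark v"
      using assms(2,5) V_eq_layers by (auto simp: anchor_def flexible_def split: if_splits)
    have "mark v \<in> set P \<inter> N1" using through_anchor(2) mark(1)[OF v(1)] v(4) by simp
    then have "last P = mark v" using P(3) by simp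
    then have "proper_path V E ext_color u (P @ [v]) v"
      using entry_path_redirect[OF P(1), of v] through_anchor(1) v mark(2)[OF v(1)]
        ext_color_mark[OF v(1,2)]
      by (simp add: insert_commute)
    then show ?thesis ..
  next
    case disjoint
    then show ?thesis using entry_paths_join[OF P(1) Q(1)] new_color_gt by simp
  qed
qed

lemma proper_path_outside_D:
  assumes "u \<in> N1 \<union> N2" "v \<in> N1 \<union> N2" "u \<noteq> v"
  shows "\<exists>p. proper_path V E ext_color u p v"
proof (cases "\<not> flexible u \<and> \<not> flexible v \<and> side u = side v")
  case True
  then show ?thesis using proper_path_same_side[OF assms] by blast
next
  case False
  then show ?thesis
    using proper_path_opposite_sides[OF assms, of "side u"]
      proper_path_opposite_sides[OF assms, of "\<not> side v"] by auto
qed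

lemma proper_path_to_D:
  assumes "u \<in> V" "y \<in> D" "u \<noteq> y"
  shows "\<exists>p. proper_path V E ext_color u p y"
proof (cases "u \<in> D")
  case True
  then obtain d where "proper_path D (induced_edges E D) ext_color u (d @ [y]) y"
    "proper_walk E ext_color (d @ [y])"
    using proper_path_within_core[OF True assms(2,3)] by blast
  then have "proper_path V E ext_color u (d @ [y]) y"
    using D_subset unfolding proper_path_iff_proper_walk by blast
  then show ?thesis ..
next
  case False
  then have "u \<in> N1 \<union> N2" using assms(1) V_eq_layers by blast
  then obtain P f where "entry_path u P f (new_color (side u))"
    using entry_path_own_side by metis
  then show ?thesis using new_color_gt assms(2) by (rule entry_path_to_core)
qed

lemma proper_path_coloring_ext_color: "proper_path_coloring V E ext_color"
  unfolding proper_path_coloring_def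
proof (intro ballI impI)
  fix u v assume uv: "u \<in> V" "v \<in> V" "u \<noteq> v"
  then consider "v \<in> D" | "u \<in> D" | "u \<in> N1 \<union> N2" "v \<in> N1 \<union> N2"
    using V_eq_layers by blast
  then show "\<exists>p. proper_path V E ext_color u p v"
  proof cases
    case 1
    then show ?thesis using proper_path_to_D uv by blast
  next
    case 2
    then have "\<exists>p. proper_path V E ext_color v p u" using proper_path_to_D uv by blast
    then show ?thesis by (rule proper_path_sym)
  next
    case 3
    then show ?thesis using proper_path_outside_D uv(3) by blast
  qed
qed

end

theorem theorem3p1:
  fixes V :: "'a set" and E :: "'a set set" and D :: "'a set"
  assumes "fin_simple_graph V E"
    and "connected_graph V E"
    and "connected_two_way_two_step_dominating V E D"
  shows "pc V E \<le> pc D (induced_edges E D) + 2"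
proof -
  interpret two_way_dominated V E D using assms by unfold_locales
  obtain label :: "'a \<Rightarrow> bool" where label:
    "\<forall>p\<in>N1. \<not> isolated p \<longrightarrow> (\<exists>q\<in>N1. linked p q \<and> label q \<noteq> label p)"
    using ex_label_opposite_to_linked ..
  obtain cD where cD: "1 \<le> pc D (induced_edges E D)"
    "cD ` induced_edges E D \<subseteq> {1..pc D (induced_edges E D)}"
    "proper_path_coloring D (induced_edges E D) cD"
    using core_pc_attained .
  interpret two_way_dominated_coloring V E D label cD "pc D (induced_edges E D)"
    by unfold_locales (use label cD in blast)+
  show ?thesis by (rule pc_le[OF _ ext_color_range proper_path_coloring_ext_color]) simp
qed

end
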